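(* For all integers $K \ge 1$ and $N \ge 1$, the procedure described in the context (Algorithm 1) returns exactly $T^* = \min\{T \in \mathbb{N} : E(T,K) \ge N\}$, where $E(T,K) = \sum_{i=1}^{K}\binom{T}{i}$, and it does so in $\mathcal{O}(\log N)$ time and $\mathcal{O}(1)$ space.
   Context: Generalized egg dropping problem: with $K$ identical test items and $N$ floors, $E(T,K) = \sum_{i=1}^{K}\binom{T}{i}$ (with $\binom{T}{i}=0$ for $i>T$) is the maximum number of floors handled by $T$ tests in the worst case, and $T^*$ is the minimum worst-case number of tests. Time counts arithmetic operations and comparisons on integers, each at unit cost; space counts the number of integer variables. Algorithm 1 on input $K \ge 1$, $N \ge 1$: (0) If $N \le 1$ or $K = 1$, return $N$. (1) Set $T_{\text{ideal}} \gets \lceil \log_2(N+1)\rceil$. If $K \ge T_{\text{ideal}}$, return $T_{\text{ideal}}$. (2) Set $L \gets 1$, $R \gets 2^{\lceil T_{\text{ideal}}/K\rceil}$ (one bitwise left shift), $E_{\text{cached}} \gets 0$, $B_{\text{cached}} \gets 1$, $T_{\text{cached}} \gets K$. While $L < R$: set $M_{\text{mid}} \gets \lfloor (L+R)/2\rfloor$, $E_{\text{mid}} \gets 0$, $\text{term} \gets 1$, $T_{\text{mid}} \gets K M_{\text{mid}}$; for $i = 1,\dots,K$: $\text{term} \gets \text{term}\cdot(T_{\text{mid}}-i+1)/i$ (exact integer division), $E_{\text{mid}} \gets E_{\text{mid}} + \text{term}$, and if $E_{\text{mid}} \ge N$ exit the for-loop. Then if $E_{\text{mid}} \ge N$ set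 $R \gets M_{\text{mid}}$; otherwise set $L \gets M_{\text{mid}}+1$, $E_{\text{cached}} \gets E_{\text{mid}}$, $B_{\text{cached}} \gets \text{term}$, $T_{\text{cached}} \gets T_{\text{mid}}$. (3) Set $E \gets E_{\text{cached}}$, $B \gets B_{\text{cached}}$, $T \gets T_{\text{cached}}$. While $E < N$: $E \gets 2E - B + 1$; $B \gets B + (B\cdot K)/(T+1-K)$ (exact integer division); $T \gets T+1$. Return $T$. *)

theory Defs
  imports Complex_Main
begin

definition E_floors :: "nat \<Rightarrow> nat \<Rightarrow> nat" where
  "E_floors T K = (\<Sum>i = 1..K. T choose i)"

text \<open>
  The algorithm is written in a small imperative language over integer variables, so that
  unit-cost time and the number of variables in use are defined by the execution itself.
\<close>

type_synonym vname = string

datatype aexp =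
    Num int
  | Var vname
  | Plus aexp aexp (infixl \<open>\<oplus>\<close> 65)
  | Minus aexp aexp (infixl \<open>\<ominus>\<close> 65)
  | Times aexp aexp (infixl \<open>\<otimes>\<close> 70)
  | ExactDiv aexp aexp (infixl \<open>\<oslash>\<close> 70)
  | FloorDiv aexp aexp
  | CeilDiv aexp aexp
  | ShiftLeft aexp aexp
  | CeilLog2 aexp

datatype bexp =
    Less aexp aexp
  | Leq aexp aexp
  | Eq aexp aexp
  | Or bexp bexp

datatype com =
    Skip
  | Assign vname aexp (infix \<open>::=\<close> 61)
  | Seq com com (infixr \<open>;;\<close> 60)
  | Cond bexp com com (\<open>(IF _/ THEN _/ ELSE _)\<close> [0, 0, 61] 61)
  | While bexp com (\<open>(WHILE _/ DO _)\<close> [0, 61] 61)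
  | Break
  | Return aexp

text \<open>Variables that have not been assigned are absent from the state.\<close>

type_synonym state = "vname \<Rightarrow> int option"

definition lift2 :: "(int \<Rightarrow> int \<Rightarrow> int option) \<Rightarrow> int option \<Rightarrow> int option \<Rightarrow> int option" where
  "lift2 f x y = Option.bind x (\<lambda>a. Option.bind y (f a))"

text \<open>
  The value \<open>None\<close> means that evaluation is stuck. In particular \<open>\<oslash>\<close> is stuck unless the
  division leaves no remainder, so a completed execution certifies that every division
  written as exact is exact.
\<close>

fun aval :: "aexp \<Rightarrow> state \<Rightarrow> int option" where
  "aval (Num n) s = Some n"
| "aval (Var x) s = s x"
| "aval (e1 \<oplus> e2) s = lift2 (\<lambda>a b. Some (a + b)) (aval e1 s) (aval e2 s)"
| "aval (e1 \<ominus> e2) s = lift2 (\<lambda>a b. Some (a - b)) (aval e1 s) (aval e2 s)"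
| "aval (e1 \<otimes> e2) s = lift2 (\<lambda>a b. Some (a * b)) (aval e1 s) (aval e2 s)"
| "aval (e1 \<oslash> e2) s =
     lift2 (\<lambda>a b. if b \<noteq> 0 \<and> b dvd a then Some (a div b) else None) (aval e1 s) (aval e2 s)"
| "aval (FloorDiv e1 e2) s =
     lift2 (\<lambda>a b. if b \<noteq> 0 then Some \<lfloor>real_of_int a / real_of_int b\<rfloor> else None) (aval e1 s) (aval e2 s)"
| "aval (CeilDiv e1 e2) s =
     lift2 (\<lambda>a b. if b \<noteq> 0 then Some \<lceil>real_of_int a / real_of_int b\<rceil> else None) (aval e1 s) (aval e2 s)"
| "aval (ShiftLeft e1 e2) s =
     lift2 (\<lambda>a b. if b \<ge> 0 then Some (a * 2 ^ nat b) else None) (aval e1 s) (aval e2 s)"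
| "aval (CeilLog2 e) s =
     Option.bind (aval e s) (\<lambda>a. if a > 0 then Some \<lceil>log 2 (real_of_int a)\<rceil> else None)"

fun bval :: "bexp \<Rightarrow> state \<Rightarrow> bool option" where
  "bval (Less e1 e2) s = Option.bind (aval e1 s) (\<lambda>a. map_option (\<lambda>b. a < b) (aval e2 s))"
| "bval (Leq e1 e2) s = Option.bind (aval e1 s) (\<lambda>a. map_option (\<lambda>b. a \<le> b) (aval e2 s))"
| "bval (Eq e1 e2) s = Option.bind (aval e1 s) (\<lambda>a. map_option (\<lambda>b. a = b) (aval e2 s))"
| "bval (Or b1 b2) s = Option.bind (bval b1 s) (\<lambda>p. map_option (\<lambda>q. p \<or> q) (bval b2 s))"

text \<open>
  One unit for each arithmetic operation and each comparison; assignments and jumps are free.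
  The rounded logarithm counts as one operation: for \<open>n \<ge> 1\<close> the number \<open>\<lceil>log 2 (n + 1)\<rceil>\<close> is
  the bit length of \<open>n\<close>.
\<close>

fun acost :: "aexp \<Rightarrow> nat" where
  "acost (Num n) = 0"
| "acost (Var x) = 0"
| "acost (e1 \<oplus> e2) = acost e1 + acost e2 + 1"
| "acost (e1 \<ominus> e2) = acost e1 + acost e2 + 1"
| "acost (e1 \<otimes> e2) = acost e1 + acost e2 + 1"
| "acost (e1 \<oslash> e2) = acost e1 + acost e2 + 1"
| "acost (FloorDiv e1 e2) = acost e1 + acost e2 + 1"
| "acost (CeilDiv e1 e2) = acost e1 + acost e2 + 1"
| "acost (ShiftLeft e1 e2) = acost e1 + acost e2 + 1"
| "acost (CeilLog2 e) = acost e + 1"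

fun bcost :: "bexp \<Rightarrow> nat" where
  "bcost (Less e1 e2) = acost e1 + acost e2 + 1"
| "bcost (Leq e1 e2) = acost e1 + acost e2 + 1"
| "bcost (Eq e1 e2) = acost e1 + acost e2 + 1"
| "bcost (Or b1 b2) = bcost b1 + bcost b2"

datatype outcome = Normal | Broken | Returned int

text \<open>
  \<open>exec c s r s' t\<close>: started in state \<open>s\<close>, the command \<open>c\<close> terminates with outcome \<open>r\<close> in
  state \<open>s'\<close> after \<open>t\<close> arithmetic operations and comparisons.
\<close>

inductive exec :: "com \<Rightarrow> state \<Rightarrow> outcome \<Rightarrow> state \<Rightarrow> nat \<Rightarrow> bool" where
  Skip: "exec Skip s Normal s 0"
| Assign: "aval e s = Some v \<Longrightarrow> exec (x ::= e) s Normal (s(x \<mapsto> v)) (acost e)"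
| Seq: "exec c1 s Normal s1 t1 \<Longrightarrow> exec c2 s1 r s2 t2 \<Longrightarrow> exec (c1 ;; c2) s r s2 (t1 + t2)"
| SeqExit: "exec c1 s r s1 t1 \<Longrightarrow> r \<noteq> Normal \<Longrightarrow> exec (c1 ;; c2) s r s1 t1"
| CondTrue: "bval b s = Some True \<Longrightarrow> exec c1 s r s1 t \<Longrightarrow>
    exec (IF b THEN c1 ELSE c2) s r s1 (bcost b + t)"
| CondFalse: "bval b s = Some False \<Longrightarrow> exec c2 s r s1 t \<Longrightarrow>
    exec (IF b THEN c1 ELSE c2) s r s1 (bcost b + t)"
| WhileFalse: "bval b s = Some False \<Longrightarrow> exec (WHILE b DO c) s Normal s (bcost b)"
| WhileTrue: "bval b s = Some True \<Longrightarrow> exec c s Normal s1 t1 \<Longrightarrow>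
    exec (WHILE b DO c) s1 r s2 t2 \<Longrightarrow> exec (WHILE b DO c) s r s2 (bcost b + t1 + t2)"
| WhileBreak: "bval b s = Some True \<Longrightarrow> exec c s Broken s1 t \<Longrightarrow>
    exec (WHILE b DO c) s Normal s1 (bcost b + t)"
| WhileReturn: "bval b s = Some True \<Longrightarrow> exec c s (Returned v) s1 t \<Longrightarrow>
    exec (WHILE b DO c) s (Returned v) s1 (bcost b + t)"
| Break: "exec Break s Broken s 0"
| Return: "aval e s = Some v \<Longrightarrow> exec (Return e) s (Returned v) s (acost e)"

inductive_cases SkipE: "exec Skip s r s' t"
inductive_cases AssignE: "exec (x ::= e) s r s' t"
inductive_cases SeqE: "exec (c1 ;; c2) s r s' t"
inductive_cases CondE: "exec (IF b THEN c1 ELSE c2) s r s' t"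
inductive_cases WhileE: "exec (WHILE b DO c) s r s' t"
inductive_cases BreakE: "exec Break s r s' t"
inductive_cases ReturnE: "exec (Return e) s r s' t"

lemma exec_deterministic:
  "exec c s r s1 t \<Longrightarrow> exec c s r' s1' t' \<Longrightarrow> r' = r \<and> s1' = s1 \<and> t' = t"
proof (induction arbitrary: r' s1' t' rule: exec.induct)
  case (Skip s)
  then show ?case by (auto elim: SkipE)
next
  case (Assign e s v x)
  then show ?case by (auto elim: AssignE)
next
  case (Seq c1 s s1 t1 c2 r s2 t2)
  show ?case by (rule SeqE[OF Seq.prems]) (metis Seq.IH)+
next
  case (SeqExit c1 s r s1 t1 c2)
  show ?case by (rule SeqE[OF SeqExit.prems]) (metis SeqExit.IH SeqExit.hyps)+
next
  case (CondTrue b s c1 r s1 t c2)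
  show ?case
    by (rule CondE[OF CondTrue.prems]) (metis CondTrue.IH CondTrue.hyps option.inject)+
next
  case (CondFalse b s c2 r s1 t c1)
  show ?case
    by (rule CondE[OF CondFalse.prems]) (metis CondFalse.IH CondFalse.hyps option.inject)+
next
  case (WhileFalse b s c)
  show ?case by (rule WhileE[OF WhileFalse.prems]) (simp_all add: WhileFalse.hyps)
next
  case (WhileTrue b s c s1 t1 r s2 t2)
  show ?case
    by (rule WhileE[OF WhileTrue.prems])
       (metis WhileTrue.IH WhileTrue.hyps option.inject outcome.distinct)+
next
  case (WhileBreak b s c s1 t)
  show ?case
    by (rule WhileE[OF WhileBreak.prems])
       (metis WhileBreak.IH WhileBreak.hyps option.inject outcome.distinct)+
next
  case (WhileReturn b s c v s1 t)
  show ?case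
    by (rule WhileE[OF WhileReturn.prems])
       (metis WhileReturn.IH WhileReturn.hyps option.inject outcome.distinct outcome.inject)+
next
  case (Break s)
  then show ?case by (auto elim: BreakE)
next
  case (Return e s v)
  then show ?case by (auto elim: ReturnE)
qed

lemma exec_dom_mono: "exec c s r s' t \<Longrightarrow> dom s \<subseteq> dom s'"
  by (induction rule: exec.induct) auto

lemma exec_finite_dom: "exec c s r s' t \<Longrightarrow> finite (dom s) \<Longrightarrow> finite (dom s')"
  by (induction rule: exec.induct) auto

text \<open>
  Since variables are never discarded, the number of variables in the final state
  is the largest number of variables in use at any time during the run.
\<close>

definition runs :: "com \<Rightarrow> state \<Rightarrow> int \<Rightarrow> nat \<Rightarrow> nat \<Rightarrow> bool" where
  "runs c s v time space \<longleftrightarrow>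
     (\<exists>s'. exec c s (Returned v) s' time \<and> space = card (dom s'))"

definition For :: "vname \<Rightarrow> aexp \<Rightarrow> aexp \<Rightarrow> com \<Rightarrow> com" where
  "For x lo hi c =
     x ::= lo ;;
     WHILE Leq (Var x) hi DO (c ;; x ::= Var x \<oplus> Num 1)"

definition egg_trivial :: com where
  "egg_trivial =
     (IF Or (Leq (Var ''N'') (Num 1)) (Eq (Var ''K'') (Num 1))
      THEN Return (Var ''N'') ELSE Skip)"

definition egg_ideal :: com where
  "egg_ideal =
     ''T_ideal'' ::= CeilLog2 (Var ''N'' \<oplus> Num 1) ;;
     (IF Leq (Var ''T_ideal'') (Var ''K'') THEN Return (Var ''T_ideal'') ELSE Skip)"

definition egg_evaluate_mid :: com where
  "egg_evaluate_mid =
     For ''i'' (Num 1) (Var ''K'')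
       (''term'' ::= (Var ''term'' \<otimes> (Var ''T_mid'' \<ominus> Var ''i'' \<oplus> Num 1)) \<oslash> Var ''i'' ;;
        ''E_mid'' ::= Var ''E_mid'' \<oplus> Var ''term'' ;;
        (IF Leq (Var ''N'') (Var ''E_mid'') THEN Break ELSE Skip))"

definition egg_binary_search :: com where
  "egg_binary_search =
     ''L'' ::= Num 1 ;;
     ''R'' ::= ShiftLeft (Num 1) (CeilDiv (Var ''T_ideal'') (Var ''K'')) ;;
     ''E_cached'' ::= Num 0 ;;
     ''B_cached'' ::= Num 1 ;;
     ''T_cached'' ::= Var ''K'' ;;
     WHILE Less (Var ''L'') (Var ''R'') DO
       (''M_mid'' ::= FloorDiv (Var ''L'' \<oplus> Var ''R'') (Num 2) ;;
        ''E_mid'' ::= Num 0 ;;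
        ''term'' ::= Num 1 ;;
        ''T_mid'' ::= Var ''K'' \<otimes> Var ''M_mid'' ;;
        egg_evaluate_mid ;;
        (IF Leq (Var ''N'') (Var ''E_mid'')
         THEN ''R'' ::= Var ''M_mid''
         ELSE (''L'' ::= Var ''M_mid'' \<oplus> Num 1 ;;
               ''E_cached'' ::= Var ''E_mid'' ;;
               ''B_cached'' ::= Var ''term'' ;;
               ''T_cached'' ::= Var ''T_mid'')))"

definition egg_linear_search :: com where
  "egg_linear_search =
     ''E'' ::= Var ''E_cached'' ;;
     ''B'' ::= Var ''B_cached'' ;;
     ''T'' ::= Var ''T_cached'' ;;
     WHILE Less (Var ''E'') (Var ''N'') DO
       (''E'' ::= Num 2 \<otimes> Var ''E'' \<ominus> Var ''B'' \<oplus> Num 1 ;;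
        ''B'' ::= Var ''B'' \<oplus> (Var ''B'' \<otimes> Var ''K'') \<oslash> (Var ''T'' \<oplus> Num 1 \<ominus> Var ''K'') ;;
        ''T'' ::= Var ''T'' \<oplus> Num 1) ;;
     Return (Var ''T'')"

definition egg_drop :: com where
  "egg_drop = egg_trivial ;; egg_ideal ;; egg_binary_search ;; egg_linear_search"

definition egg_input :: "nat \<Rightarrow> nat \<Rightarrow> state" where
  "egg_input K N = [''K'' \<mapsto> int K, ''N'' \<mapsto> int N]"

end

theory Submission
  imports Defs
begin

text \<open>
  If the search of step (2) is reached, then \<open>K < T_ideal\<close>, so \<open>E_floors K K = 2 ^ K - 1 < N\<close>: the
  bound \<open>L = 1\<close> cannot survive, and the cached values are genuine when step (3) starts.
  The initial \<open>R\<close> is feasible because \<open>K * M choose K \<ge> M ^ K\<close>. The binary search takes at most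
  \<open>\<lceil>T_ideal / K\<rceil>\<close> rounds of \<open>O(K)\<close> operations, and leaves an interval of length \<open>K\<close> for the linear
  search, which updates \<open>E_floors T K\<close> and \<open>T choose K\<close> by Pascal's rule. Since \<open>K < T_ideal\<close>,
  everything is \<open>O(T_ideal)\<close>.
\<close>

section \<open>Sums of binomial coefficients\<close>

lemma E_floors_0 [simp]: "E_floors T 0 = 0"
  by (simp add: E_floors_def)

lemma E_floors_Suc_right: "E_floors T (Suc K) = E_floors T K + (T choose Suc K)"
  by (simp add: E_floors_def)

lemma E_floors_1_right: "E_floors T 1 = T"
  by (simp add: E_floors_def)

lemma E_floors_mono_left: "T \<le> T' \<Longrightarrow> E_floors T K \<le> E_floors T' K"
  by (auto simp: E_floors_def intro!: sum_mono binomial_right_mono)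

lemma E_floors_mono_right: "K \<le> K' \<Longrightarrow> E_floors T K \<le> E_floors T K'"
  by (auto simp: E_floors_def intro!: sum_mono2)

lemma E_floors_less_imp_less: "E_floors T K < E_floors T' K \<Longrightarrow> T < T'"
  by (meson E_floors_mono_left leD leI)

lemma choose_le_E_floors: "1 \<le> K \<Longrightarrow> T choose K \<le> E_floors T K"
  by (cases K) (auto simp: E_floors_Suc_right)

text \<open>Pascal's rule summed over \<open>i = 1..K\<close>: the shifted terms run over
  \<open>0..K-1\<close>, gaining the term 1 and losing \<open>T choose K\<close>. This is the update
  of \<open>E\<close> in the linear search, put additively to avoid truncated subtraction.\<close>

lemma E_floors_Suc_left: "E_floors (Suc T) K + (T choose K) = 2 * E_floors T K + 1"
  by (induction K) (auto simp: E_floors_Suc_right)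

text \<open>For \<open>T \<le> K\<close> the sum covers all of row \<open>T\<close> of Pascal's
  triangle except index 0, which \<open>Suc\<close> restores.\<close>

lemma E_floors_eq_power: "T \<le> K \<Longrightarrow> Suc (E_floors T K) = 2 ^ T"
proof -
  assume "T \<le> K"
  have "Suc (E_floors T K) = (\<Sum>i\<le>K. T choose i)"
    by (induction K) (auto simp: E_floors_Suc_right)
  also have "\<dots> = (\<Sum>i\<le>T. T choose i)"
    using \<open>T \<le> K\<close> by (intro sum.mono_neutral_right) auto
  finally show ?thesis by (simp add: choose_row_sum)
qed

text \<open>By monotonicity in \<open>T\<close>, only the predecessor of \<open>T\<close> has to be
  ruled out.\<close>

lemma Least_E_floors_eqI:
  assumes "N \<le> E_floors T K" and "T = 0 \<or> E_floors (T - 1) K < N"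
  shows "(LEAST T. E_floors T K \<ge> N) = T"
proof (rule Least_equality)
  fix T' assume "N \<le> E_floors T' K"
  with assms(2) show "T \<le> T'"
    using E_floors_less_imp_less[of "T - 1" K T'] by (cases "T = 0") auto
qed (fact assms(1))

lemma power_le_E_floors: "1 \<le> K \<Longrightarrow> 1 \<le> M \<Longrightarrow> M ^ K \<le> E_floors (K * M) K"
proof -
  assume K: "1 \<le> K" and M: "1 \<le> M"
  have "(real (K * M) / real K) ^ K \<le> real (K * M choose K)"
    using M by (intro binomial_ge_n_over_k_pow_k) simp
  then have "real (M ^ K) \<le> real (K * M choose K)"
    using K by simp
  then have "M ^ K \<le> (K * M choose K)"
    by (simp only: of_nat_le_iff)
  also have "\<dots> \<le> E_floors (K * M) K"
    using K by (rule choose_le_E_floors)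
  finally show ?thesis .
qed

text \<open>The absorption identity
  \<open>Suc j * (T choose Suc j) = (T - j) * (T choose j)\<close>. It certifies the exact division
  of the inner loop, where \<open>i = Suc j\<close>.\<close>

lemma choose_Suc_right_div:
  assumes "j < T"
  shows "int (Suc j) dvd int (T choose j) * int (T - j)"
    and "int (T choose j) * int (T - j) div int (Suc j) = int (T choose Suc j)"
proof -
  have "Suc j * (T choose Suc j) = (T - j) * (T choose j)"
    using assms binomial_absorb_comp binomial_absorption by (metis binomial_absorption add.commute)
  then have *: "int (T choose j) * int (T - j) = int (Suc j) * int (T choose Suc j)"
    by (metis mult.commute of_nat_mult)
  show "int (Suc j) dvd int (T choose j) * int (T - j)"
    by (simp only: * dvd_triv_left)
  show "int (T choose j) * int (T - j) div int (Suc j) = int (T choose Suc j)"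
    by (simp only: *) (rule nonzero_mult_div_cancel_left, simp)
qed

text \<open>Subtracting \<open>(T + 1 - K) * (T choose K)\<close> from
  \<open>(T + 1 - K) * (Suc T choose K) = (T + 1) * (T choose K)\<close> shows that the quotient is
  the increment of the binomial coefficient.\<close>

lemma choose_Suc_left_div:
  assumes "K \<le> T"
  shows "int T + 1 - int K dvd int (T choose K) * int K"
    and "int (T choose K) + int (T choose K) * int K div (int T + 1 - int K) = int (Suc T choose K)"
proof -
  have "(Suc T - K) * (Suc T choose K) = Suc T * (T choose K)"
    using binomial_absorb_comp[of "Suc T" K] by simp
  then have "(int T + 1 - int K) * int (Suc T choose K) = (int T + 1) * int (T choose K)"
    using assms by (metis Suc_eq_plus1 le_SucI of_nat_Suc of_nat_diff of_nat_mult add.commute)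
  then have *: "int (T choose K) * int K
      = (int T + 1 - int K) * (int (Suc T choose K) - int (T choose K))"
    by (simp add: algebra_simps)
  show "int T + 1 - int K dvd int (T choose K) * int K"
    by (simp only: * dvd_triv_left)
  have "int T + 1 - int K \<noteq> 0" using assms by simp
  then show "int (T choose K) + int (T choose K) * int K div (int T + 1 - int K)
      = int (Suc T choose K)"
    by (simp only: * nonzero_mult_div_cancel_left) simp
qed

section \<open>Weakest preconditions with running time\<close>

text \<open>Existence of a run is total correctness: it includes termination and exactness of the
  divisions performed. The equations below let the simplifier execute loop-free code symbolically
  while adding up its cost.\<close>

definition wp :: "com \<Rightarrow> (outcome \<Rightarrow> state \<Rightarrow> nat \<Rightarrow> bool) \<Rightarrow> state \<Rightarrow> bool" where
  "wp c Q s \<longleftrightarrow> (\<exists>r s' t. exec c s r s' t \<and> Q r s' t)"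

lemma wpI: "exec c s r s' t \<Longrightarrow> Q r s' t \<Longrightarrow> wp c Q s"
  unfolding wp_def by blast

lemma wp_mono: "wp c P s \<Longrightarrow> (\<And>r s' t. P r s' t \<Longrightarrow> Q r s' t) \<Longrightarrow> wp c Q s"
  unfolding wp_def by blast

lemma wp_Skip [simp]: "wp Skip Q s \<longleftrightarrow> Q Normal s 0"
  by (auto simp: wp_def elim: SkipE intro: exec.Skip)

lemma wp_Break [simp]: "wp Break Q s \<longleftrightarrow> Q Broken s 0"
  by (auto simp: wp_def elim: BreakE intro: exec.Break)

lemma wp_Assign [simp]:
  "wp (x ::= e) Q s \<longleftrightarrow> (\<exists>v. aval e s = Some v \<and> Q Normal (s(x \<mapsto> v)) (acost e))"
  by (auto simp: wp_def elim!: AssignE intro: exec.Assign)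

lemma wp_Return [simp]:
  "wp (Return e) Q s \<longleftrightarrow> (\<exists>v. aval e s = Some v \<and> Q (Returned v) s (acost e))"
  by (auto simp: wp_def elim!: ReturnE intro: exec.Return)

lemma wp_Seq [simp]:
  "wp (c1 ;; c2) Q s \<longleftrightarrow>
     wp c1 (\<lambda>r s1 t1. if r = Normal then wp c2 (\<lambda>r s2 t2. Q r s2 (t1 + t2)) s1 else Q r s1 t1) s"
    (is "_ \<longleftrightarrow> wp c1 ?R s")
proof
  assume "wp (c1 ;; c2) Q s"
  then obtain r s2 t where "exec (c1 ;; c2) s r s2 t" "Q r s2 t"
    unfolding wp_def by blast
  then show "wp c1 ?R s"
    by (elim SeqE) (auto intro!: wpI)
next
  assume "wp c1 ?R s"
  then obtain r s1 t1 where c1: "exec c1 s r s1 t1" and R: "?R r s1 t1"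
    unfolding wp_def by blast
  show "wp (c1 ;; c2) Q s"
  proof (cases "r = Normal")
    case True
    with R obtain r' s2 t2 where "exec c2 s1 r' s2 t2" "Q r' s2 (t1 + t2)"
      unfolding wp_def by auto
    with c1 True show ?thesis
      unfolding wp_def by (auto intro: exec.Seq)
  next
    case False
    with c1 R show ?thesis
      unfolding wp_def by (auto intro: exec.SeqExit)
  qed
qed

lemma wp_Cond [simp]:
  "wp (IF b THEN c1 ELSE c2) Q s \<longleftrightarrow>
     (case bval b s of None \<Rightarrow> False
      | Some v \<Rightarrow> wp (if v then c1 else c2) (\<lambda>r s' t. Q r s' (bcost b + t)) s)"
proof (cases "bval b s")
  case None
  then show ?thesis by (auto simp: wp_def elim: CondE)
next
  case (Some v)
  then show ?thesis
    by (cases v) (auto simp: wp_def elim!: CondE intro: exec.CondTrue exec.CondFalse)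
qed

text \<open>The index of \<open>I\<close> bounds the number of remaining iterations, each of cost at most \<open>C\<close>.\<close>

lemma wp_While:
  assumes "I m s"
    and step: "\<And>m s. I m s \<Longrightarrow>
      (bval b s = Some False \<and> P s) \<or>
      (bval b s = Some True \<and> 0 < m \<and>
        wp c (\<lambda>r s' t. bcost b + t \<le> C \<and> (r = Normal \<and> I (m - 1) s' \<or> r = Broken \<and> P s')) s)"
  shows "wp (WHILE b DO c) (\<lambda>r s' t. r = Normal \<and> P s' \<and> t \<le> C * m + bcost b) s"
  using assms(1)
proof (induction m arbitrary: s rule: less_induct)
  case (less m)
  from step[OF less.prems] show ?case
  proof (elim disjE conjE)
    assume "bval b s = Some False" "P s"
    then show ?thesis
      unfolding wp_def using exec.WhileFalse by fastforce
  next
    assume b: "bval b s = Some True" and m: "0 < m"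
      and w: "wp c (\<lambda>r s' t. bcost b + t \<le> C \<and>
                 (r = Normal \<and> I (m - 1) s' \<or> r = Broken \<and> P s')) s"
    from w obtain r s1 t where c: "exec c s r s1 t" and t: "bcost b + t \<le> C"
      and r: "r = Normal \<and> I (m - 1) s1 \<or> r = Broken \<and> P s1"
      unfolding wp_def by blast
    obtain k where k: "m = Suc k" using m gr0_implies_Suc by blast
    from r show ?thesis
    proof (elim disjE conjE)
      assume "r = Normal" "I (m - 1) s1"
      with less.IH[of "m - 1" s1] m obtain s2 t2
        where w: "exec (WHILE b DO c) s1 Normal s2 t2" "P s2" "t2 \<le> C * (m - 1) + bcost b"
        unfolding wp_def by auto
      have "exec (WHILE b DO c) s Normal s2 (bcost b + t + t2)"
        using b c w \<open>r = Normal\<close> by (auto intro: exec.WhileTrue)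
      moreover have "bcost b + t + t2 \<le> C * m + bcost b"
        using w t by (simp add: k)
      ultimately show ?thesis using w unfolding wp_def by blast
    next
      \<comment> \<open>Since \<open>0 < m\<close>, the budget \<open>C * m\<close> still pays for
        the interrupted iteration.\<close>
      assume "r = Broken" "P s1"
      have "exec (WHILE b DO c) s Normal s1 (bcost b + t)"
        using b c \<open>r = Broken\<close> by (auto intro: exec.WhileBreak)
      moreover have "bcost b + t \<le> C * m + bcost b"
        using t by (simp add: k)
      ultimately show ?thesis using \<open>P s1\<close> unfolding wp_def by blast
    qed
  qed
qed

section \<open>Variables a command can assign\<close>

fun assigned :: "com \<Rightarrow> vname set" where
  "assigned (x ::= e) = {x}"
| "assigned (c1 ;; c2) = assigned c1 \<union> assigned c2"
| "assigned (IF b THEN c1 ELSE c2) = assigned c1 \<union> assigned c2"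
| "assigned (WHILE b DO c) = assigned c"
| "assigned Skip = {}"
| "assigned Break = {}"
| "assigned (Return e) = {}"

lemma finite_assigned [simp]: "finite (assigned c)"
  by (induction c) auto

text \<open>The set \<open>assigned c\<close> depends on the program text alone, so its size bounds
  the space uniformly in the input.\<close>

lemma exec_dom_subset: "exec c s r s' t \<Longrightarrow> dom s' \<subseteq> dom s \<union> assigned c"
  by (induction rule: exec.induct) (simp_all add: subset_iff dom_def, metis+)

section \<open>Execution of the phases\<close>

text \<open>After an early exit \<open>E_mid\<close> is only a partial sum, but it decides the
  comparison with \<open>N\<close> as the full sum would. A result below \<open>N\<close> means that
  the loop ran to its end, so the values to be cached are genuine. Each round costs 8 operations,
  its guard included; the final guard adds 1.\<close>

lemma wp_egg_evaluate_mid: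
  assumes "s ''K'' = Some (int K)" "s ''N'' = Some (int N)" "s ''T_mid'' = Some (int T)"
    and "s ''term'' = Some 1" "s ''E_mid'' = Some 0" and "K \<le> T"
  shows "wp egg_evaluate_mid (\<lambda>r s' t. r = Normal \<and>
      ((\<forall>x. x \<notin> {''i'', ''term'', ''E_mid''} \<longrightarrow> s' x = s x) \<and>
       (\<exists>e. s' ''E_mid'' = Some e \<and> (int N \<le> e \<longleftrightarrow> N \<le> E_floors T K) \<and>
         (e < int N \<longrightarrow> e = int (E_floors T K) \<and> s' ''term'' = Some (int (T choose K))))) \<and>
      t \<le> 8 * K + 1) s"
    (is "wp _ (\<lambda>r s' t. r = Normal \<and> ?P s' \<and> _) s")
proof -
  \<comment> \<open>\<open>j\<close> terms have been added and \<open>m\<close> are left;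
    \<open>i\<close> is one ahead of \<open>j\<close>.\<close>
  define I where "I m s' \<longleftrightarrow> (\<exists>j. m + j = K \<and> (\<forall>x. x \<notin> {''i'', ''term'', ''E_mid''} \<longrightarrow> s' x = s x) \<and>
      s' ''i'' = Some (int (Suc j)) \<and> s' ''term'' = Some (int (T choose j)) \<and>
      s' ''E_mid'' = Some (int (E_floors T j)))" for m s'
  let ?b = "Leq (Var ''i'') (Var ''K'')"
  let ?c = "(''term'' ::= (Var ''term'' \<otimes> (Var ''T_mid'' \<ominus> Var ''i'' \<oplus> Num 1)) \<oslash> Var ''i'' ;;
        ''E_mid'' ::= Var ''E_mid'' \<oplus> Var ''term'' ;;
        (IF Leq (Var ''N'') (Var ''E_mid'') THEN Break ELSE Skip)) ;;
        ''i'' ::= Var ''i'' \<oplus> Num 1"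
  have "wp (WHILE ?b DO ?c) (\<lambda>r s' t. r = Normal \<and> ?P s' \<and> t \<le> 8 * K + bcost ?b)
          (s(''i'' \<mapsto> 1))"
  proof (rule wp_While[where I = I])
    show "I K (s(''i'' \<mapsto> 1))"
      using assms by (auto simp: I_def)
  next
    fix m s'
    assume "I m s'"
    then obtain j where j: "m + j = K" and frame: "\<forall>x. x \<notin> {''i'', ''term'', ''E_mid''} \<longrightarrow> s' x = s x"
      and vars: "s' ''i'' = Some (int (Suc j))" "s' ''term'' = Some (int (T choose j))"
        "s' ''E_mid'' = Some (int (E_floors T j))"
      unfolding I_def by blast
    have inputs: "s' ''K'' = Some (int K)" "s' ''N'' = Some (int N)" "s' ''T_mid'' = Some (int T)"
      using frame assms by auto
    show "bval ?b s' = Some False \<and> ?P s' \<or> bval ?b s' = Some True \<and> 0 < m \<and>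
        wp ?c (\<lambda>r s' t. bcost ?b + t \<le> 8 \<and> (r = Normal \<and> I (m - 1) s' \<or> r = Broken \<and> ?P s')) s'"
    proof (cases "m = 0")
      case True
      with j frame vars inputs show ?thesis by auto
    next
      case False
      with j assms have "j < T" "Suc j \<le> K" by auto
      have diff: "int T - int (Suc j) + 1 = int (T - j)"
        using \<open>j < T\<close> by simp
      note div = choose_Suc_right_div[OF \<open>j < T\<close>]
      have le: "E_floors T (Suc j) \<le> E_floors T K"
        using \<open>Suc j \<le> K\<close> by (rule E_floors_mono_right)
      let ?s1 = "s'(''term'' \<mapsto> int (T choose Suc j), ''E_mid'' \<mapsto> int (E_floors T (Suc j)))"
      have E: "int (E_floors T j) + int (T choose Suc j) = int (E_floors T (Suc j))"
        by (simp add: E_floors_Suc_right)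
      have "I (m - 1) (?s1(''i'' \<mapsto> int (Suc j) + 1))"
        using j False frame unfolding I_def by (intro exI[of _ "Suc j"]) simp
      \<comment> \<open>State after \<open>Break\<close>: partial sums grow with \<open>j\<close>,
        so the full sum also reaches \<open>N\<close>, and the clause for \<open>e < int N\<close>
        is vacuous.\<close>
      moreover have "?P ?s1" if "N \<le> E_floors T (Suc j)"
        using that le frame by simp
      ultimately show ?thesis
        using False \<open>Suc j \<le> K\<close>
        by (cases "N \<le> E_floors T (Suc j)")
          (simp_all add: lift2_def vars inputs diff div E del: of_nat_Suc)
    qed
  qed
  then show ?thesis
    using assms by (simp add: egg_evaluate_mid_def For_def)
qed

text \<open>The cache belongs to the infeasible midpoint \<open>L - 1\<close>, because
  \<open>L\<close> was set to \<open>M_mid + 1\<close> when it was filled.\<close>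

definition bracketed :: "nat \<Rightarrow> nat \<Rightarrow> nat \<Rightarrow> state \<Rightarrow> bool" where
  "bracketed K N L s \<longleftrightarrow> E_floors (K * (L - 1)) K < N \<and>
     s ''E_cached'' = Some (int (E_floors (K * (L - 1)) K)) \<and>
     s ''B_cached'' = Some (int (K * (L - 1) choose K)) \<and>
     s ''T_cached'' = Some (int (K * (L - 1)))"

text \<open>A round costs at most \<open>8 * K + 1\<close> for the evaluation plus 6: guard, two for
  the midpoint, product, comparison and increment. The final 3 are the shift, the rounded quotient
  and the last guard.\<close>

lemma wp_egg_binary_search:
  assumes "s ''K'' = Some (int K)" "s ''N'' = Some (int N)" "s ''T_ideal'' = Some (int D)"
    and "1 \<le> K" "2 ^ K \<le> N" "N < 2 ^ D"
  shows "wp egg_binary_search (\<lambda>r s' t. r = Normal \<and>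
      (s' ''K'' = Some (int K) \<and> s' ''N'' = Some (int N) \<and>
       (\<exists>L\<ge>2. bracketed K N L s' \<and> N \<le> E_floors (K * L) K)) \<and>
      t \<le> (8 * K + 7) * nat \<lceil>real D / real K\<rceil> + 3) s"
    (is "wp _ (\<lambda>r s' t. r = Normal \<and> ?P s' \<and> _) s")
proof -
  define c where "c = nat \<lceil>real D / real K\<rceil>"
  \<comment> \<open>The form in which the simplifier asks for a nonnegative ceiling.\<close>
  have nonneg: "- 1 < real D / real K"
    by (rule less_le_trans[of _ 0]) auto
  have c: "\<lceil>real D / real K\<rceil> = int c"
    using nonneg unfolding c_def by simp
  \<comment> \<open>\<open>R < L + 2 ^ m\<close> forces \<open>L = R\<close> at
    \<open>m = 0\<close>. The case \<open>L = 1\<close> is separate because the initial cache need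
    not hold values of \<open>E_floors\<close> and \<open>choose\<close>.\<close>
  define I where "I m s' \<longleftrightarrow> s' ''K'' = Some (int K) \<and> s' ''N'' = Some (int N) \<and>
      (\<exists>L R. s' ''L'' = Some (int L) \<and> s' ''R'' = Some (int R) \<and>
        1 \<le> L \<and> L \<le> R \<and> R < L + 2 ^ m \<and> N \<le> E_floors (K * R) K \<and>
        (L = 1 \<or> bracketed K N L s'))" for m s'
  let ?b = "Less (Var ''L'') (Var ''R'')"
  let ?upd = "IF Leq (Var ''N'') (Var ''E_mid'')
         THEN ''R'' ::= Var ''M_mid''
         ELSE (''L'' ::= Var ''M_mid'' \<oplus> Num 1 ;;
               ''E_cached'' ::= Var ''E_mid'' ;;
               ''B_cached'' ::= Var ''term'' ;;
               ''T_cached'' ::= Var ''T_mid'')"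
  let ?c = "''M_mid'' ::= FloorDiv (Var ''L'' \<oplus> Var ''R'') (Num 2) ;;
        ''E_mid'' ::= Num 0 ;;
        ''term'' ::= Num 1 ;;
        ''T_mid'' ::= Var ''K'' \<otimes> Var ''M_mid'' ;;
        egg_evaluate_mid ;;
        ?upd"
  let ?s = "s(''L'' \<mapsto> 1, ''R'' \<mapsto> 2 ^ c, ''E_cached'' \<mapsto> 0, ''B_cached'' \<mapsto> 1, ''T_cached'' \<mapsto> int K)"
  \<comment> \<open>Rules out \<open>L = R = 1\<close> on exit, where feasibility of
    \<open>R\<close> would give \<open>N \<le> E_floors K K\<close>.\<close>
  have "E_floors K K < N"
    using E_floors_eq_power[of K K] assms by simp
  have "wp (WHILE ?b DO ?c) (\<lambda>r s' t. r = Normal \<and> ?P s' \<and> t \<le> (8 * K + 7) * c + bcost ?b) ?s"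
  proof (rule wp_While[where I = I])
    have "real D / real K \<le> real c"
      using c by (metis le_of_int_ceiling of_int_of_nat_eq)
    then have "real D \<le> real (c * K)"
      using assms by (simp add: field_simps)
    then have "D \<le> c * K"
      by (simp only: of_nat_le_iff)
    then have "(2::nat) ^ D \<le> (2 ^ c) ^ K"
      by (simp add: power_mult[symmetric])
    also have "\<dots> \<le> E_floors (K * 2 ^ c) K"
      using assms by (intro power_le_E_floors) auto
    finally have "N \<le> E_floors (K * 2 ^ c) K"
      using assms by simp
    then show "I c ?s"
      using assms unfolding I_def
      by (auto intro!: exI[of _ 1] exI[of _ "2 ^ c"])
  next
    fix m s'
    assume "I m s'"
    then obtain L R where inputs: "s' ''K'' = Some (int K)" "s' ''N'' = Some (int N)"
      and vars: "s' ''L'' = Some (int L)" "s' ''R'' = Some (int R)"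
      and LR: "1 \<le> L" "L \<le> R" "R < L + 2 ^ m" and R: "N \<le> E_floors (K * R) K"
      and L: "L = 1 \<or> bracketed K N L s'"
      unfolding I_def by blast
    show "bval ?b s' = Some False \<and> ?P s' \<or> bval ?b s' = Some True \<and> 0 < m \<and>
        wp ?c (\<lambda>r s' t. bcost ?b + t \<le> 8 * K + 7 \<and>
          (r = Normal \<and> I (m - 1) s' \<or> r = Broken \<and> ?P s')) s'"
    proof (cases "L = R")
      case True
      with R \<open>E_floors K K < N\<close> have "L \<noteq> 1" by auto
      with LR L R True inputs vars show ?thesis
        by (auto intro!: exI[of _ R])
    next
      case False
      then have m: "0 < m" using LR by (cases m) auto
      then obtain k where k: "m = Suc k" using gr0_implies_Suc by blast
      define M where "M = (L + R) div 2"
      have mid: "\<lfloor>(real L + real R) / 2\<rfloor> = int M"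
        using floor_divide_of_nat_eq[of "L + R" 2] by (simp add: M_def)
      \<comment> \<open>The last two bounds are the halved interval for the updates
        \<open>R := M\<close> and \<open>L := M + 1\<close>.\<close>
      have M: "L \<le> M" "M < R" "M < L + 2 ^ k" "R < M + 1 + 2 ^ k"
        using LR False k by (auto simp: M_def)
      let ?s1 = "s'(''M_mid'' \<mapsto> int M, ''E_mid'' \<mapsto> 0, ''term'' \<mapsto> 1, ''T_mid'' \<mapsto> int (K * M))"
      have "wp egg_evaluate_mid (\<lambda>r s'' t. r = Normal \<and>
          ((\<forall>x. x \<notin> {''i'', ''term'', ''E_mid''} \<longrightarrow> s'' x = ?s1 x) \<and>
           (\<exists>e. s'' ''E_mid'' = Some e \<and> (int N \<le> e \<longleftrightarrow> N \<le> E_floors (K * M) K) \<and>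
             (e < int N \<longrightarrow> e = int (E_floors (K * M) K) \<and>
                s'' ''term'' = Some (int (K * M choose K))))) \<and>
          t \<le> 8 * K + 1) ?s1"
        using inputs M LR by (intro wp_egg_evaluate_mid) auto
      \<comment> \<open>The shape of the continuation in \<open>wp_Seq\<close>;
        \<open>8 * K + 3\<close> is the budget left after the guard, the midpoint and the product
        have taken 4.\<close>
      then have "wp egg_evaluate_mid (\<lambda>r s1 t1. if r = Normal then
          wp ?upd (\<lambda>r s2 t2. t1 + t2 \<le> 8 * K + 3 \<and> r = Normal \<and> I k s2) s1 else False) ?s1"
      proof (rule wp_mono, elim conjE exE)
        fix r s'' t e
        assume r: "r = Normal" and t: "t \<le> 8 * K + 1"
          and frame: "\<forall>x. x \<notin> {''i'', ''term'', ''E_mid''} \<longrightarrow> s'' x = ?s1 x"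
          and e: "s'' ''E_mid'' = Some e" "int N \<le> e \<longleftrightarrow> N \<le> E_floors (K * M) K"
            "e < int N \<longrightarrow> e = int (E_floors (K * M) K) \<and> s'' ''term'' = Some (int (K * M choose K))"
        have vars': "s'' ''K'' = Some (int K)" "s'' ''N'' = Some (int N)" "s'' ''L'' = Some (int L)"
            "s'' ''R'' = Some (int R)" "s'' ''M_mid'' = Some (int M)" "s'' ''T_mid'' = Some (int (K * M))"
            "s'' ''E_cached'' = s' ''E_cached''" "s'' ''B_cached'' = s' ''B_cached''"
            "s'' ''T_cached'' = s' ''T_cached''"
          using frame inputs vars by auto
        show "if r = Normal then
          wp ?upd (\<lambda>r s2 t2. t + t2 \<le> 8 * K + 3 \<and> r = Normal \<and> I k s2) s'' else False"
        proof (cases "int N \<le> e")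
          case True
          then have "I k (s''(''R'' \<mapsto> int M))"
            using e vars' L LR M unfolding I_def bracketed_def
            by (auto intro!: exI[of _ L] exI[of _ M])
          with True r t e vars' show ?thesis by simp
        next
          case False
          then have "I k (s''(''L'' \<mapsto> int M + 1, ''E_cached'' \<mapsto> e,
              ''B_cached'' \<mapsto> int (K * M choose K), ''T_cached'' \<mapsto> int (K * M)))"
            using e vars' R M unfolding I_def bracketed_def
            by (auto intro!: exI[of _ "Suc M"])
          with False r t e vars' show ?thesis by (simp add: lift2_def)
        qed
      qed
      then show ?thesis
        using LR False m vars inputs mid k
        by (auto simp: lift2_def simp del: wp_Cond elim!: wp_mono split: if_splits)
    qed
  qed
  then show ?thesis
    using assms c nonneg
    by (simp add: egg_binary_search_def lift2_def c_def[symmetric])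
qed

text \<open>From the infeasible \<open>K * (L - 1)\<close> to the feasible \<open>K * L\<close>
  there are at most \<open>K\<close> increments, each costing 10 with its guard.
  \<open>2 \<le> L\<close> ensures \<open>K \<le> T\<close>, as the exact division requires.\<close>

lemma wp_egg_linear_search:
  assumes "s ''K'' = Some (int K)" "s ''N'' = Some (int N)"
    and "1 \<le> K" "2 \<le> L" "bracketed K N L s" "N \<le> E_floors (K * L) K"
  shows "wp egg_linear_search
      (\<lambda>r s' t. r = Returned (int (LEAST T. E_floors T K \<ge> N)) \<and> t \<le> 10 * K + 1) s"
proof -
  \<comment> \<open>Infeasibility of \<open>T - 1\<close> is what \<open>Least_E_floors_eqI\<close>
    needs on exit; \<open>K * L \<le> T + m\<close> bounds the remaining increments.\<close>
  define I where "I m s' \<longleftrightarrow> s' ''K'' = Some (int K) \<and> s' ''N'' = Some (int N) \<and>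
      (\<exists>T. s' ''T'' = Some (int T) \<and> s' ''E'' = Some (int (E_floors T K)) \<and>
        s' ''B'' = Some (int (T choose K)) \<and> K \<le> T \<and> K * L \<le> T + m \<and>
        E_floors (T - 1) K < N)" for m s'
  let ?b = "Less (Var ''E'') (Var ''N'')"
  let ?c = "''E'' ::= Num 2 \<otimes> Var ''E'' \<ominus> Var ''B'' \<oplus> Num 1 ;;
        ''B'' ::= Var ''B'' \<oplus> (Var ''B'' \<otimes> Var ''K'') \<oslash> (Var ''T'' \<oplus> Num 1 \<ominus> Var ''K'') ;;
        ''T'' ::= Var ''T'' \<oplus> Num 1"
  let ?T = "K * (L - 1)"
  let ?s = "s(''E'' \<mapsto> int (E_floors ?T K), ''B'' \<mapsto> int (?T choose K), ''T'' \<mapsto> int ?T)"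
  have "wp (WHILE ?b DO ?c) (\<lambda>r s' t. r = Normal \<and>
          s' ''T'' = Some (int (LEAST T. E_floors T K \<ge> N)) \<and> t \<le> 10 * K + bcost ?b) ?s"
  proof (rule wp_While[where I = I])
    have "E_floors (?T - 1) K \<le> E_floors ?T K"
      by (rule E_floors_mono_left) simp
    then have "E_floors (?T - 1) K < N"
      using assms by (simp add: bracketed_def)
    moreover have "K \<le> ?T" "K * L \<le> ?T + K"
      using assms by (cases L; simp)+
    ultimately show "I K ?s"
      using assms unfolding I_def by (auto intro!: exI[of _ ?T])
  next
    fix m s'
    assume "I m s'"
    then obtain T where vars: "s' ''K'' = Some (int K)" "s' ''N'' = Some (int N)"
        "s' ''T'' = Some (int T)" "s' ''E'' = Some (int (E_floors T K))"
        "s' ''B'' = Some (int (T choose K))"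
      and T: "K \<le> T" "K * L \<le> T + m" "E_floors (T - 1) K < N"
      unfolding I_def by blast
    show "bval ?b s' = Some False \<and> s' ''T'' = Some (int (LEAST T. E_floors T K \<ge> N)) \<or>
        bval ?b s' = Some True \<and> 0 < m \<and>
        wp ?c (\<lambda>r s' t. bcost ?b + t \<le> 10 \<and> (r = Normal \<and> I (m - 1) s' \<or>
          r = Broken \<and> s' ''T'' = Some (int (LEAST T. E_floors T K \<ge> N)))) s'"
    proof (cases "E_floors T K < N")
      case True
      then have "T < K * L"
        using assms E_floors_less_imp_less[of T K "K * L"] by simp
      then have m: "0 < m" "K * L \<le> Suc T + (m - 1)"
        using T by auto
      have E: "2 * int (E_floors T K) - int (T choose K) + 1 = int (E_floors (Suc T) K)"
        using E_floors_Suc_left[of T K] by simp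
      note B = choose_Suc_left_div[OF \<open>K \<le> T\<close>]
      have "I (m - 1) (s'(''E'' \<mapsto> int (E_floors (Suc T) K), ''B'' \<mapsto> int (Suc T choose K),
          ''T'' \<mapsto> int T + 1))"
        using vars T m True unfolding I_def by (auto intro!: exI[of _ "Suc T"])
      moreover have "int T + 1 - int K \<noteq> 0"
        using T by simp
      ultimately show ?thesis
        using vars m True by (simp add: lift2_def E B)
    next
      case False
      with T vars show ?thesis
        using Least_E_floors_eqI[of N T K] by simp
    qed
  qed
  then have "wp (WHILE ?b DO ?c) (\<lambda>r s' t. if r = Normal then
      s' ''T'' = Some (int (LEAST T. E_floors T K \<ge> N)) \<and> t \<le> 10 * K + 1 else False) ?s"
    by (rule wp_mono) auto
  then show ?thesis
    using assms
    by (auto simp: egg_linear_search_def bracketed_def elim!: wp_mono split: if_splits)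
qed

section \<open>Correctness and cost of the whole program\<close>

lemma wp_egg_drop:
  assumes "1 \<le> K" "1 \<le> N"
  shows "wp egg_drop (\<lambda>r s t. r = Returned (int (LEAST T. E_floors T K \<ge> N)) \<and>
      t \<le> 40 * nat \<lceil>log 2 (real N + 1)\<rceil> + 9) (egg_input K N)"
proof -
  define D where "D = nat \<lceil>log 2 (real N + 1)\<rceil>"
  have "0 < log 2 (real N + 1)"
    using assms by simp
  then have D: "\<lceil>log 2 (real N + 1)\<rceil> = int D"
    unfolding D_def by linarith
  then have "0 < D" using \<open>0 < log 2 (real N + 1)\<close> by linarith
  have "real N + 1 \<le> 2 ^ D"
  proof -
    have "log 2 (real N + 1) \<le> real D" using D by linarith
    then show ?thesis
      by (simp add: log_le_iff powr_realpow)
  qed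
  then have upper: "N < 2 ^ D"
    by (metis Suc_eq_plus1 Suc_le_eq of_nat_1 of_nat_add of_nat_le_iff of_nat_numeral of_nat_power)
  \<comment> \<open>Used at \<open>k = D - 1\<close> for minimality of the early answer, and at
    \<open>k = K\<close> to enter the binary search.\<close>
  have lower: "2 ^ k \<le> N" if "k < D" for k
  proof -
    have "real k < log 2 (real N + 1)" using D that by linarith
    then have "2 ^ k < real N + 1"
      by (simp add: less_log_iff powr_realpow)
    then have "real (2 ^ k) < real (Suc N)" by simp
    then show ?thesis
      by (simp only: of_nat_less_iff less_Suc_eq_le)
  qed
  let ?s = "egg_input K N"
  have inputs: "?s ''K'' = Some (int K)" "?s ''N'' = Some (int N)"
    by (auto simp: egg_input_def)
  consider "N \<le> 1 \<or> K = 1" | "\<not> (N \<le> 1 \<or> K = 1)" "D \<le> K" | "\<not> (N \<le> 1 \<or> K = 1)" "K < D"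
    by linarith
  then show ?thesis
  proof cases
    case 1
    have "(LEAST T. E_floors T K \<ge> N) = N"
    proof (rule Least_E_floors_eqI)
      show "N \<le> E_floors N K"
        using E_floors_mono_right[of 1 K N] E_floors_1_right[of N] assms by linarith
      show "N = 0 \<or> E_floors (N - 1) K < N"
        using 1 assms E_floors_eq_power[of 0 K] E_floors_1_right[of "N - 1"] by auto
    qed
    with 1 inputs show ?thesis
      by (simp add: egg_drop_def egg_trivial_def)
  next
    case 2
    have "(LEAST T. E_floors T K \<ge> N) = D"
    proof (rule Least_E_floors_eqI)
      show "N \<le> E_floors D K"
        using E_floors_eq_power[of D K] upper 2 by simp
      show "D = 0 \<or> E_floors (D - 1) K < N"
        using E_floors_eq_power[of "D - 1" K] lower[of "D - 1"] 2 \<open>0 < D\<close> by linarith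
    qed
    with 2 inputs D show ?thesis
      by (simp add: egg_drop_def egg_trivial_def egg_ideal_def lift2_def)
  next
    case 3
    define c where "c = nat \<lceil>real D / real K\<rceil>"
    \<comment> \<open>Multiplied by \<open>K < D\<close>, this bounds rounds times \<open>K\<close>
      by \<open>D + K < 2 * D\<close>.\<close>
    have "real c < real D / real K + 1"
      unfolding c_def using less_le_trans[of "-1" 0 "real D / real K"] by simp linarith
    then have "real (c * K) < real (D + K)"
      using assms by (simp add: field_simps)
    then have "c * K < 2 * D"
      using 3 by (simp only: of_nat_less_iff)
    moreover have "c \<le> c * K" using assms by simp
    moreover have "(8 * K + 7) * c = 8 * (c * K) + 7 * c" by (simp add: algebra_simps)
    \<comment> \<open>\<open>16 * D + 14 * D + 10 * D\<close> bounds the three products. The 9 is 5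
      for the two tests preceding the search, 3 for the binary search and 1 for the linear
      search.\<close>
    ultimately have cost: "(8 * K + 7) * c + 10 * K + 9 \<le> 40 * D + 9"
      using 3 by linarith
    let ?s1 = "?s(''T_ideal'' \<mapsto> int D)"
    have "wp egg_binary_search (\<lambda>r s' t. r = Normal \<and>
        (s' ''K'' = Some (int K) \<and> s' ''N'' = Some (int N) \<and>
         (\<exists>L\<ge>2. bracketed K N L s' \<and> N \<le> E_floors (K * L) K)) \<and>
        t \<le> (8 * K + 7) * c + 3) ?s1"
      unfolding c_def using assms inputs upper lower[OF 3(2)] by (intro wp_egg_binary_search) auto
    then have "wp egg_binary_search (\<lambda>r s1 t1. if r = Normal then
        wp egg_linear_search (\<lambda>r s t2. r = Returned (int (LEAST T. E_floors T K \<ge> N)) \<and>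
          5 + t1 + t2 \<le> 40 * D + 9) s1 else False) ?s1"
    proof (rule wp_mono, elim conjE exE)
      fix r s' t L
      assume "r = Normal" "s' ''K'' = Some (int K)" "s' ''N'' = Some (int N)" "2 \<le> L"
        "bracketed K N L s'" "N \<le> E_floors (K * L) K" "t \<le> (8 * K + 7) * c + 3"
      then show "if r = Normal then
        wp egg_linear_search (\<lambda>r s t2. r = Returned (int (LEAST T. E_floors T K \<ge> N)) \<and>
          5 + t + t2 \<le> 40 * D + 9) s' else False"
        using wp_egg_linear_search[of s' K N L] cost assms by (auto elim!: wp_mono)
    qed
    then show ?thesis
      using 3 inputs D
      by (auto simp: egg_drop_def egg_trivial_def egg_ideal_def lift2_def
          elim!: wp_mono split: if_splits)
  qed
qed

text \<open>\<open>N + 1 \<le> 2 * N\<close> costs 1 in the logarithm and rounding up less than 1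
  more. The maximum keeps the bound positive at \<open>N = 1\<close>, where \<open>log 2 N\<close>
  vanishes.\<close>

lemma ceiling_log2_le:
  assumes "1 \<le> N"
  shows "real (nat \<lceil>log 2 (real N + 1)\<rceil>) \<le> 3 * max 1 (log 2 (real N))"
proof -
  have "log 2 (real N + 1) \<le> log 2 (2 * real N)"
    using assms by simp
  also have "\<dots> = 1 + log 2 (real N)"
    using assms by (simp add: log_mult)
  finally have "log 2 (real N + 1) \<le> 1 + log 2 (real N)" .
  moreover have "0 \<le> log 2 (real N + 1)"
    by simp
  ultimately show ?thesis
    by linarith
qed

theorem theorem1:
  "\<exists>(c :: real) (d :: nat). \<forall>K N :: nat. K \<ge> 1 \<longrightarrow> N \<ge> 1 \<longrightarrow>
     (\<exists>time space. runs egg_drop (egg_input K N) (int (LEAST T. E_floors T K \<ge> N)) time space \<and>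
        real time \<le> c * max 1 (log 2 (real N)) \<and> space \<le> d)"
proof (rule exI[of _ 129], rule exI[of _ "card ({''K'', ''N''} \<union> assigned egg_drop)"], intro allI impI)
  let ?vars = "{''K'', ''N''} \<union> assigned egg_drop"
  fix K N :: nat
  assume "1 \<le> K" "1 \<le> N"
  then obtain s t
    where s: "exec egg_drop (egg_input K N) (Returned (int (LEAST T. E_floors T K \<ge> N))) s t"
      and t: "t \<le> 40 * nat \<lceil>log 2 (real N + 1)\<rceil> + 9"
    using wp_egg_drop unfolding wp_def by blast
  have "dom s \<subseteq> ?vars"
    using exec_dom_subset[OF s] by (auto simp: egg_input_def split: if_splits)
  then have "card (dom s) \<le> card ?vars"
    by (intro card_mono) auto
  \<comment> \<open>\<open>129 = 40 * 3 + 9\<close>, the 9 being absorbed because the maximum is at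
    least 1.\<close>
  moreover have "real t \<le> 129 * max 1 (log 2 (real N))"
  proof -
    have "real t \<le> 40 * real (nat \<lceil>log 2 (real N + 1)\<rceil>) + 9"
      using t by linarith
    then show ?thesis
      using ceiling_log2_le[OF \<open>1 \<le> N\<close>] by linarith
  qed
  ultimately show "\<exists>time space.
      runs egg_drop (egg_input K N) (int (LEAST T. E_floors T K \<ge> N)) time space \<and>
      real time \<le> 129 * max 1 (log 2 (real N)) \<and> space \<le> card ?vars"
    using s unfolding runs_def by blast
qed

end
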